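(* There exist a constant $C>0$ and an integer $N$ such that for every $n\ge N$ there is a connected graph $X$ of order $n$ with $\operatorname{th}_d(X)\ge C n^{2/3}$; i.e., there exist connected graphs of order $n$ with $\operatorname{th}_d(X)=\Omega(n^{2/3})$.
   Context: Cops and Robbers on a finite simple graph with $n$ vertices: in round $0$ each of $k$ cops and then the robber choose a vertex; in each later round each cop stays or moves along an edge, then the robber does the same; capture occurs when a cop occupies the robber's vertex. A vertex is damaged if the robber occupies it in a round in which capture does not occur. $\operatorname{dmg}_k(G)$ is the minimum number of vertices damaged over all games with $k$ cops when the robber places and plays to maximize damage, and $\operatorname{th}_d(G)=\min_{1\le k\le n}\{k+\operatorname{dmg}_k(G)\}$. *)

theory Defs
  imports Complex_Main "Graph_Theory.Graph_Theory"
begin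

text \<open>
  Finite simple graphs are \<^locale>\<open>pair_graph\<close>s: finite, loopless and symmetric, with the arcs being
  pairs of vertices, so that each edge is represented by its two orientations.
\<close>

definition legal_move :: "'a pair_pre_digraph \<Rightarrow> 'a \<Rightarrow> 'a \<Rightarrow> bool" where
  "legal_move G u v \<longleftrightarrow> u \<in> pverts G \<and> (v = u \<or> (u, v) \<in> parcs G)"

text \<open>
  A strategy for the cops maps the list of the robber's positions in rounds \<open>0, \<dots>, t - 1\<close> to
  the list of the cops' positions in round \<open>t\<close> (the \<open>i\<close>-th entry belongs to the \<open>i\<close>-th cop, and
  several cops may share a vertex). The cops' own earlier positions are determined by the strategy
  and the robber's earlier positions, so they need not be recorded.
\<close>

definition cop_strategy :: "'a pair_pre_digraph \<Rightarrow> nat \<Rightarrow> ('a list \<Rightarrow> 'a list) \<Rightarrow> bool" where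
  "cop_strategy G k \<sigma> \<longleftrightarrow>
     length (\<sigma> []) = k \<and> set (\<sigma> []) \<subseteq> pverts G \<and>
     (\<forall>h x. list_all2 (legal_move G) (\<sigma> h) (\<sigma> (h @ [x])))"

definition robber_play :: "'a pair_pre_digraph \<Rightarrow> (nat \<Rightarrow> 'a) \<Rightarrow> bool" where
  "robber_play G r \<longleftrightarrow> r 0 \<in> pverts G \<and> (\<forall>t. legal_move G (r t) (r (Suc t)))"

definition cops_at :: "('a list \<Rightarrow> 'a list) \<Rightarrow> (nat \<Rightarrow> 'a) \<Rightarrow> nat \<Rightarrow> 'a set" where
  "cops_at \<sigma> r t = set (\<sigma> (map r [0..<t]))"

text \<open>
  In a round \<open>t \<ge> 1\<close> the robber can be captured either by the cops' move, while he is still on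
  \<open>r (t - 1)\<close>, or by himself moving onto a cop.
\<close>

definition capture :: "('a list \<Rightarrow> 'a list) \<Rightarrow> (nat \<Rightarrow> 'a) \<Rightarrow> nat \<Rightarrow> bool" where
  "capture \<sigma> r t \<longleftrightarrow> (t \<ge> 1 \<and> r (t - 1) \<in> cops_at \<sigma> r t) \<or> r t \<in> cops_at \<sigma> r t"

text \<open>
  The game ends with the first capture; what \<open>r\<close> and \<open>\<sigma>\<close> prescribe afterwards is irrelevant.
  The vertex \<open>r t\<close> reached in round \<open>t\<close> (round \<open>0\<close> included) is damaged if no capture has occurred
  up to and including round \<open>t\<close>. (Some authors also require that the robber survive the cops' next
  move; that excludes at most the last vertex of a play, so it changes the damage by at most one.)
\<close>

definition damaged :: "('a list \<Rightarrow> 'a list) \<Rightarrow> (nat \<Rightarrow> 'a) \<Rightarrow> 'a set" where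
  "damaged \<sigma> r = {r t | t. \<forall>s\<le>t. \<not> capture \<sigma> r s}"

text \<open>
  The cops minimise over their strategies what the robber can maximally achieve. Against a fixed
  strategy of the cops, a strategy of the robber amounts to a sequence of moves. The supremum is a
  maximum, since at most \<open>card (pverts G)\<close> vertices can be damaged.
\<close>

definition dmg :: "nat \<Rightarrow> 'a pair_pre_digraph \<Rightarrow> nat" where
  "dmg k G = (INF \<sigma>\<in>{\<sigma>. cop_strategy G k \<sigma>}. SUP r\<in>{r. robber_play G r}. card (damaged \<sigma> r))"

definition th_d :: "'a pair_pre_digraph \<Rightarrow> nat" where
  "th_d G = Min ((\<lambda>k. k + dmg k G) ` {1..card (pverts G)})"

end

theory Submission
  imports Defs "HOL-Algebra.Algebraic_Closure_Type" "HOL-Library.Z2"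
begin

text \<open>
  In the incidence graph of the affine plane over a field with \<open>q\<close> elements (without the vertical
  lines), a cop other than the robber's own vertex blocks at most one of the robber's \<open>q\<close> next
  vertices. Hence \<open>q / 8\<close> cops cannot stop a robber who alternates between lines and
  points: as long as at most half of the \<open>q\<^sup>2\<close> points are damaged, some unblocked line through his
  point contains more undamaged points than the cops can block. So he damages about \<open>q\<^sup>2 / 2\<close> points
  within \<open>q\<^sup>2\<close> rounds. Now hang \<open>q\<close> copies of this graph on a path, at distance \<open>2q\<^sup>2\<close> from one
  another. This takes about \<open>q\<^sup>3\<close> vertices. Of fewer than \<open>q\<^sup>2 / 8\<close> cops, at most \<open>q / 8\<close> start near a
  suitable copy, and the others arrive too late.
\<close>

text \<open>\<open>HOL-Algebra\<close> reserves the letter \<open>X\<close>, which the theorem uses as a variable.\<close>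

no_notation Polynomials.var (\<open>X\<index>\<close>)

section \<open>Evading few cops\<close>

definition covers :: "'a pair_pre_digraph \<Rightarrow> 'a \<Rightarrow> 'a \<Rightarrow> bool" where
  "covers G u v \<longleftrightarrow> u = v \<or> (u, v) \<in> parcs G"

lemma legal_move_imp_covers: "legal_move G u v \<Longrightarrow> covers G u v"
  by (auto simp: legal_move_def covers_def)

text \<open>
  After the robber's moves, no cop can capture him at once; this rules out both kinds of capture.
\<close>

definition uncovered_upto :: "'a pair_pre_digraph \<Rightarrow> ('a list \<Rightarrow> 'a list) \<Rightarrow> (nat \<Rightarrow> 'a) \<Rightarrow> nat \<Rightarrow> bool" where
  "uncovered_upto G \<sigma> r t \<longleftrightarrow> (\<forall>s\<le>t. \<forall>c\<in>cops_at \<sigma> r s. \<not> covers G c (r s))"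

section \<open>Plays, strategies and captures\<close>

lemma cop_strategy_step:
  assumes "cop_strategy G k \<sigma>"
  shows "list_all2 (legal_move G) (\<sigma> (map r [0..<t])) (\<sigma> (map r [0..<Suc t]))"
  using assms by (simp add: cop_strategy_def)

lemma cop_strategy_length:
  assumes "cop_strategy G k \<sigma>"
  shows "length (\<sigma> (map r [0..<t])) = k"
proof (induction t)
  case 0
  show ?case using assms by (simp add: cop_strategy_def)
next
  case (Suc t)
  then show ?case using list_all2_lengthD[OF cop_strategy_step[OF assms, of r t]] by simp
qed

lemma (in pair_wf_digraph) cops_at_subset:
  assumes "cop_strategy G k \<sigma>"
  shows "cops_at \<sigma> r t \<subseteq> pverts G"
proof (induction t)
  case 0
  show ?case using assms by (simp add: cop_strategy_def cops_at_def)
next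
  case (Suc t)
  show ?case
  proof
    fix c assume "c \<in> cops_at \<sigma> r (Suc t)"
    then obtain j where j: "j < length (\<sigma> (map r [0..<Suc t]))" "c = \<sigma> (map r [0..<Suc t]) ! j"
      by (metis cops_at_def in_set_conv_nth)
    then have "legal_move G (\<sigma> (map r [0..<t]) ! j) c"
      using cop_strategy_step[OF assms, of r t] by (metis list_all2_nthD2)
    then show "c \<in> pverts G"
      by (auto simp: legal_move_def dest: in_arcsD2)
  qed
qed

text \<open>One move lowers \<open>f\<close> by at most one. With \<open>f\<close> a lower bound for
  the distance to a plane, a cop that starts far away cannot be near the plane early on.\<close>

lemma cop_distance:
  fixes f :: "'a \<Rightarrow> nat"
  assumes \<sigma>: "cop_strategy G k \<sigma>" and "j < k"
    and f: "\<And>u v. (u, v) \<in> parcs G \<Longrightarrow> f u \<le> f v + 1"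
  shows "f (\<sigma> [] ! j) \<le> f (\<sigma> (map r [0..<t]) ! j) + t"
proof (induction t)
  case (Suc t)
  have "legal_move G (\<sigma> (map r [0..<t]) ! j) (\<sigma> (map r [0..<Suc t]) ! j)"
    using cop_strategy_step[OF \<sigma>, of r t] \<open>j < k\<close> cop_strategy_length[OF \<sigma>, of r t]
    by (metis list_all2_nthD)
  then have "f (\<sigma> (map r [0..<t]) ! j) \<le> f (\<sigma> (map r [0..<Suc t]) ! j) + 1"
    by (auto simp: legal_move_def dest: f)
  with Suc show ?case by linarith
qed simp

text \<open>A cop that arrives on the robber's vertex covered it one round earlier. This excludes
  capture by the cops' move.\<close>

lemma cops_do_not_reach_uncovered:
  assumes \<sigma>: "cop_strategy G k \<sigma>" and r: "uncovered_upto G \<sigma> r t"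
  shows "r t \<notin> cops_at \<sigma> r (Suc t)"
proof
  assume "r t \<in> cops_at \<sigma> r (Suc t)"
  then obtain j where j: "j < length (\<sigma> (map r [0..<Suc t]))" "r t = \<sigma> (map r [0..<Suc t]) ! j"
    by (metis cops_at_def in_set_conv_nth)
  define c where "c = \<sigma> (map r [0..<t]) ! j"
  have "legal_move G c (r t)"
    using j cop_strategy_step[OF \<sigma>, of r t] unfolding c_def by (metis list_all2_nthD2)
  moreover have "c \<in> cops_at \<sigma> r t"
    using j unfolding c_def cops_at_def by (metis cop_strategy_length[OF \<sigma>] nth_mem)
  ultimately show False
    using r by (auto simp: uncovered_upto_def dest: legal_move_imp_covers)
qed

lemma not_capture_if_uncovered_upto:
  assumes \<sigma>: "cop_strategy G k \<sigma>" and r: "uncovered_upto G \<sigma> r t" and "s \<le> t"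
  shows "\<not> capture \<sigma> r s"
proof -
  have "r s \<notin> cops_at \<sigma> r s"
    using r \<open>s \<le> t\<close> by (auto simp: uncovered_upto_def covers_def)
  moreover have "r (s - 1) \<notin> cops_at \<sigma> r s" if "s \<ge> 1"
    using cops_do_not_reach_uncovered[OF \<sigma>, of r "s - 1"] r \<open>s \<le> t\<close> that
    by (simp add: uncovered_upto_def)
  ultimately show ?thesis by (auto simp: capture_def)
qed

lemma image_subset_damaged:
  assumes "cop_strategy G k \<sigma>" "uncovered_upto G \<sigma> r t"
  shows "r ` {..t} \<subseteq> damaged \<sigma> r"
  using not_capture_if_uncovered_upto[OF assms] by (fastforce simp: damaged_def)

lemma cops_at_cong: "(\<And>s. s < t \<Longrightarrow> r s = r' s) \<Longrightarrow> cops_at \<sigma> r t = cops_at \<sigma> r' t"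
  unfolding cops_at_def by (metis (mono_tags, lifting) atLeastLessThan_iff map_eq_conv set_upt)

text \<open>The cops' positions in round \<open>t + 1\<close> depend on the play up to round \<open>t\<close> only.\<close>

lemma (in pair_wf_digraph) extend_robber_play:
  assumes r: "robber_play G r" "uncovered_upto G \<sigma> r t"
    and w: "(r t, w) \<in> parcs G" "\<And>c. c \<in> cops_at \<sigma> r (Suc t) \<Longrightarrow> \<not> covers G c w"
  obtains r' where "robber_play G r'" "uncovered_upto G \<sigma> r' (Suc t)" "r' (Suc t) = w"
    "\<And>s. s \<le> t \<Longrightarrow> r' s = r s"
proof
  \<comment> \<open>After round \<open>t + 1\<close> the robber rests on \<open>w\<close>, which
    keeps the play legal; the claims about covering concern only the rounds up to
    \<open>t + 1\<close>.\<close>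
  define r' where "r' = (\<lambda>s. if s \<le> t then r s else w)"
  have cops: "cops_at \<sigma> r' s = cops_at \<sigma> r s" if "s \<le> Suc t" for s
    by (rule cops_at_cong) (use that in \<open>auto simp: r'_def\<close>)
  show "robber_play G r'"
    unfolding robber_play_def
  proof (intro conjI allI)
    show "r' 0 \<in> pverts G" using r by (simp add: r'_def robber_play_def)
    show "legal_move G (r' s) (r' (Suc s))" for s
      using r w in_arcsD1 in_arcsD2
      by (cases s t rule: linorder_cases) (auto simp: r'_def robber_play_def legal_move_def)
  qed
  show "uncovered_upto G \<sigma> r' (Suc t)"
    using r w cops by (auto simp: uncovered_upto_def r'_def le_Suc_eq)
  show "r' (Suc t) = w" "\<And>s. s \<le> t \<Longrightarrow> r' s = r s" by (simp_all add: r'_def)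
qed

section \<open>Damage as a statement about all cop strategies\<close>

lemma (in pair_wf_digraph) robber_play_verts: "robber_play G r \<Longrightarrow> r t \<in> pverts G"
  by (induction t) (auto simp: robber_play_def legal_move_def dest: in_arcsD2)

lemma (in pair_wf_digraph) damaged_subset: "robber_play G r \<Longrightarrow> damaged \<sigma> r \<subseteq> pverts G"
  by (auto simp: damaged_def robber_play_verts)

text \<open>Infimum and supremum act as minimum and maximum here: resting cops and a resting robber
  make both index sets non-empty, and the damage is bounded by the number of vertices.\<close>

lemma (in pair_fin_digraph) le_dmg_iff:
  assumes "pverts G \<noteq> {}"
  shows "s \<le> dmg k G \<longleftrightarrow>
    (\<forall>\<sigma>. cop_strategy G k \<sigma> \<longrightarrow> (\<exists>r. robber_play G r \<and> s \<le> card (damaged \<sigma> r)))"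
proof -
  obtain v where v: "v \<in> pverts G" using assms by blast
  define D where "D = (\<lambda>\<sigma>. (\<lambda>r. card (damaged \<sigma> r)) ` {r. robber_play G r})"
  have "D \<sigma> \<subseteq> {..card (pverts G)}" for \<sigma>
    using damaged_subset pair_finite_verts by (auto simp: D_def intro!: card_mono)
  then have fin: "finite (D \<sigma>)" for \<sigma>
    using finite_subset by blast
  have "robber_play G (\<lambda>_. v)"
    using v by (simp add: robber_play_def legal_move_def)
  then have ne: "D \<sigma> \<noteq> {}" for \<sigma>
    by (auto simp: D_def)
  have "cop_strategy G k (\<lambda>_. replicate k v)"
    using v by (auto simp: cop_strategy_def legal_move_def list_all2_same)
  then have "s \<le> dmg k G \<longleftrightarrow> (\<forall>\<sigma>\<in>{\<sigma>. cop_strategy G k \<sigma>}. s \<le> Sup (D \<sigma>))"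
    unfolding dmg_def D_def by (subst le_cINF_iff) auto
  also have "\<dots> \<longleftrightarrow> (\<forall>\<sigma>. cop_strategy G k \<sigma> \<longrightarrow> (\<exists>x\<in>D \<sigma>. s \<le> x))"
    using fin ne by (simp add: cSup_eq_Max Max_ge_iff)
  finally show ?thesis by (auto simp: D_def)
qed

text \<open>
  \<open>P\<close> and \<open>L\<close> are the points and lines of one plane. The function \<open>f\<close> bounds from below the distance
  of a vertex to the plane.
\<close>

locale robber_arena = pair_graph G for G :: "'a pair_pre_digraph" +
  fixes P L :: "'a set" and f :: "'a \<Rightarrow> nat" and q :: nat
  assumes P_verts: "P \<subseteq> pverts G" and L_verts: "L \<subseteq> pverts G" and P_L_disjoint: "P \<inter> L = {}"
    and f_zero: "v \<in> P \<union> L \<Longrightarrow> f v = 0"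
    and f_Lipschitz: "(u, v) \<in> parcs G \<Longrightarrow> f u \<le> f v + 1"
    and card_P: "card P = q ^ 2"
    and card_covered: "u \<in> pverts G \<Longrightarrow> card {p \<in> P. covers G u p} \<le> q"
    and card_pencil: "v \<in> P \<Longrightarrow> card {l \<in> L. (v, l) \<in> parcs G} \<le> q"
    and card_noncollinear:
      "v \<in> P \<Longrightarrow> card {p \<in> P. \<not> (\<exists>l\<in>L. (v, l) \<in> parcs G \<and> (l, p) \<in> parcs G)} \<le> q"
    and card_covered_lines: "v \<in> P \<Longrightarrow> u \<in> pverts G \<Longrightarrow> u \<noteq> v \<Longrightarrow>
      card {l \<in> L. (v, l) \<in> parcs G \<and> covers G u l} \<le> 1"
    and card_covered_points: "l \<in> L \<Longrightarrow> u \<in> pverts G \<Longrightarrow> u \<noteq> l \<Longrightarrow>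
      card {p \<in> P. (l, p) \<in> parcs G \<and> covers G u p} \<le> 1"
begin

section \<open>A robber alternating between points and lines\<close>

lemma finite_P: "finite P" and finite_L: "finite L"
  using P_verts L_verts pair_finite_verts by (auto intro: finite_subset)

text \<open>Only cops that start with \<open>f\<close>-value below \<open>T\<close> can cover a
  vertex of the plane in round \<open>t\<close>, and each of them covers at most \<open>d\<close>
  vertices of \<open>S\<close>. The bound \<open>d\<close> is demanded only at occupied vertices, so
  that a vertex known to be free of cops can be left out.\<close>

lemma card_covered_by_cops:
  assumes \<sigma>: "cop_strategy G k \<sigma>" and near: "card {j. j < k \<and> f (\<sigma> [] ! j) < T} \<le> \<kappa>"
    and t: "t + 2 \<le> T" and S: "S \<subseteq> P \<union> L"
    and d: "\<And>c. c \<in> cops_at \<sigma> r t \<Longrightarrow> c \<in> pverts G \<Longrightarrow> card {w \<in> S. covers G c w} \<le> d"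
  shows "card {w \<in> S. \<exists>c\<in>cops_at \<sigma> r t. covers G c w} \<le> \<kappa> * d"
proof -
  define J where "J = {j. j < k \<and> f (\<sigma> [] ! j) < T}"
  define c where "c = (\<lambda>j. \<sigma> (map r [0..<t]) ! j)"
  have len: "length (\<sigma> (map r [0..<t])) = k" by (rule cop_strategy_length[OF \<sigma>])
  have fin: "finite S" using S finite_P finite_L finite_subset by blast
  have "{w \<in> S. \<exists>c\<in>cops_at \<sigma> r t. covers G c w} \<subseteq> (\<Union>j\<in>J. {w \<in> S. covers G (c j) w})"
  proof clarify
    fix w x assume w: "w \<in> S" "x \<in> cops_at \<sigma> r t" "covers G x w"
    then obtain j where j: "j < k" "x = c j"
      unfolding cops_at_def c_def by (metis in_set_conv_nth len)
    have "f w = 0" using w S f_zero by blast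
    then have "f (c j) \<le> 1" using w j f_Lipschitz[of x w] by (auto simp: covers_def)
    \<comment> \<open>Covering \<open>w\<close> puts the cop at value at most 1, so it started at
      value at most \<open>t + 1 < T\<close>.\<close>
    then have "f (\<sigma> [] ! j) < T"
      using cop_distance[OF \<sigma> \<open>j < k\<close>, of f r t] f_Lipschitz t unfolding c_def by fastforce
    then show "w \<in> (\<Union>j\<in>J. {w \<in> S. covers G (c j) w})"
      using j w by (auto simp: J_def)
  qed
  then have "card {w \<in> S. \<exists>c\<in>cops_at \<sigma> r t. covers G c w} \<le> card (\<Union>j\<in>J. {w \<in> S. covers G (c j) w})"
    by (intro card_mono) (auto simp: J_def fin)
  also have "\<dots> \<le> (\<Sum>j\<in>J. card {w \<in> S. covers G (c j) w})"
    by (rule card_UN_le) (simp add: J_def)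
  also have "\<dots> \<le> card J * d"
  proof -
    have "card {w \<in> S. covers G (c j) w} \<le> d" if "j \<in> J" for j
    proof (rule d)
      show "c j \<in> cops_at \<sigma> r t"
        using that len by (auto simp: J_def c_def cops_at_def)
      then show "c j \<in> pverts G" using cops_at_subset[OF \<sigma>] by blast
    qed
    then show ?thesis using sum_bounded_above[of J _ d] by simp
  qed
  also have "\<dots> \<le> \<kappa> * d" using near by (simp add: J_def)
  finally show ?thesis .
qed

text \<open>Each induction step plays two rounds, from a point over a line to an unvisited point.
  Before it, fewer than \<open>s\<close> points have been visited, so more than
  \<open>2 * (\<kappa> * q) + q\<close> remain, enough to find an unblocked line with many of them.
  \<open>2 * s \<le> T\<close> keeps far cops away during the whole play.\<close>

lemma robber_evades:
  assumes \<sigma>: "cop_strategy G k \<sigma>" and near: "card {j. j < k \<and> f (\<sigma> [] ! j) < T} \<le> \<kappa>"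
    and T: "2 * s \<le> T" and s: "2 * (\<kappa> * q) + q + s \<le> q ^ 2" and "m < s"
  shows "\<exists>r. robber_play G r \<and> uncovered_upto G \<sigma> r (2 * m) \<and> r (2 * m) \<in> P \<and>
    card (r ` {..2 * m} \<inter> P) = m + 1"
  using \<open>m < s\<close>
proof (induction m)
  case 0
  \<comment> \<open>The cops' first positions do not depend on the play. Each near cop covers at
    most \<open>q\<close> points, so fewer than \<open>q ^ 2\<close> points are covered.\<close>
  have "card {p \<in> P. \<exists>c\<in>cops_at \<sigma> r 0. covers G c p} \<le> \<kappa> * q" for r :: "nat \<Rightarrow> 'a"
    by (rule card_covered_by_cops[OF \<sigma> near]) (use 0 T card_covered in auto)
  then have "card {p \<in> P. \<exists>c\<in>set (\<sigma> []). covers G c p} < card P"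
    using 0 s card_P by (fastforce simp: cops_at_def)
  then have "{p \<in> P. \<exists>c\<in>set (\<sigma> []). covers G c p} \<noteq> P" by (metis less_irrefl)
  then obtain p where p: "p \<in> P" "\<And>c. c \<in> set (\<sigma> []) \<Longrightarrow> \<not> covers G c p" by blast
  then have "robber_play G (\<lambda>_. p) \<and> uncovered_upto G \<sigma> (\<lambda>_. p) (2 * 0) \<and> card ((\<lambda>_. p) ` {..2 * 0::nat} \<inter> P) = 0 + 1"
    using P_verts by (auto simp: robber_play_def legal_move_def uncovered_upto_def cops_at_def)
  then show ?case using p by blast
next
  case (Suc m)
  then obtain r where r: "robber_play G r" "uncovered_upto G \<sigma> r (2 * m)" "r (2 * m) \<in> P"
    and card_r: "card (r ` {..2 * m} \<inter> P) = m + 1"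
    by auto
  define v where "v = r (2 * m)"
  define U where "U = P - r ` {..2 * m}"
  define pts where "pts = (\<lambda>l. {p \<in> P. (l, p) \<in> parcs G})"
  define lns where "lns = {l \<in> L. (v, l) \<in> parcs G}"
  define bad where "bad = {l \<in> lns. \<exists>c\<in>cops_at \<sigma> r (Suc (2 * m)). covers G c l}"
  \<comment> \<open>A cop on \<open>v\<close> would cover all lines through \<open>v\<close>; from
    any other vertex it covers at most one.\<close>
  have no_cop: "v \<notin> cops_at \<sigma> r (Suc (2 * m))"
    unfolding v_def by (rule cops_do_not_reach_uncovered[OF \<sigma> r(2)])
  have bad: "card bad \<le> \<kappa> * 1"
    unfolding bad_def
    by (rule card_covered_by_cops[OF \<sigma> near])
      (use Suc.prems T no_cop r card_covered_lines[of v] in \<open>auto simp: lns_def v_def\<close>)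
  have fin: "finite lns" "finite bad" "finite (pts l)" "finite U" for l
    using finite_P finite_L by (auto simp: lns_def bad_def pts_def U_def)
  have pts: "card (pts l) \<le> q" if "l \<in> lns" for l
  proof -
    have "l \<in> pverts G" using that L_verts by (auto simp: lns_def)
    have "card (pts l) \<le> card {p \<in> P. covers G l p}"
      by (rule card_mono) (auto simp: pts_def covers_def finite_P)
    then show ?thesis using card_covered[OF \<open>l \<in> pverts G\<close>] by linarith
  qed
  have "card (P - r ` {..2 * m}) = q ^ 2 - (m + 1)"
    using card_r card_P card_Diff_subset_Int[of P "r ` {..2 * m}"] by (simp add: Int_commute)
  then have card_U: "2 * (\<kappa> * q) + q < card U"
    using s Suc.prems by (simp add: U_def)
  \<comment> \<open>Otherwise \<open>U\<close> has at most \<open>q\<close> points not joined to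
    \<open>v\<close>, at most \<open>\<kappa> * q\<close> on the blocked lines and at most
    \<open>q * \<kappa>\<close> on the other lines through \<open>v\<close>, contradicting
    \<open>card_U\<close>.\<close>
  have "\<exists>l\<in>lns - bad. \<kappa> < card (U \<inter> pts l)"
  proof (rule ccontr)
    assume "\<not> ?thesis"
    then have small: "card (U \<inter> pts l) \<le> \<kappa>" if "l \<in> lns - bad" for l
      using that by (meson not_le)
    define N where "N = {p \<in> P. \<not> (\<exists>l\<in>L. (v, l) \<in> parcs G \<and> (l, p) \<in> parcs G)}"
    have "U \<subseteq> N \<union> ((\<Union>l\<in>bad. pts l) \<union> (\<Union>l\<in>lns - bad. U \<inter> pts l))"
      by (auto simp: U_def N_def pts_def lns_def)
    then have "card U \<le> card (N \<union> ((\<Union>l\<in>bad. pts l) \<union> (\<Union>l\<in>lns - bad. U \<inter> pts l)))"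
      by (rule card_mono[rotated]) (use fin finite_P in \<open>auto simp: N_def\<close>)
    also have "\<dots> \<le> card N + (card (\<Union>l\<in>bad. pts l) + card (\<Union>l\<in>lns - bad. U \<inter> pts l))"
      by (meson add_left_mono card_Un_le order_trans)
    also have "card N \<le> q"
      unfolding N_def v_def by (rule card_noncollinear[OF r(3)])
    also have "card (\<Union>l\<in>bad. pts l) \<le> (\<Sum>l\<in>bad. card (pts l))"
      by (rule card_UN_le) (use fin in auto)
    also have "\<dots> \<le> card bad * q"
      using sum_bounded_above[of bad "\<lambda>l. card (pts l)" q] pts by (simp add: bad_def)
    also have "\<dots> \<le> \<kappa> * q" using bad by simp
    also have "card (\<Union>l\<in>lns - bad. U \<inter> pts l) \<le> (\<Sum>l\<in>lns - bad. card (U \<inter> pts l))"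
      by (rule card_UN_le) (use fin in auto)
    also have "\<dots> \<le> card (lns - bad) * \<kappa>"
      using sum_bounded_above[of "lns - bad" "\<lambda>l. card (U \<inter> pts l)" \<kappa>] small by simp
    also have "\<dots> \<le> card lns * \<kappa>"
      by (intro mult_right_mono card_mono) (use fin in auto)
    also have "\<dots> \<le> q * \<kappa>"
      using card_pencil[OF r(3)] by (simp add: lns_def v_def)
    finally show False using card_U by (simp add: mult.commute)
  qed
  then obtain l where l: "l \<in> lns" "l \<notin> bad" "\<kappa> < card (U \<inter> pts l)" by blast
  obtain r1 where r1: "robber_play G r1" "uncovered_upto G \<sigma> r1 (Suc (2 * m))" "r1 (Suc (2 * m)) = l"
    and r1_eq: "\<And>s. s \<le> 2 * m \<Longrightarrow> r1 s = r s"
    by (rule extend_robber_play[OF r(1,2), of l])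
      (use l in \<open>auto simp: lns_def bad_def v_def\<close>)
  \<comment> \<open>The cops answer the move to \<open>l\<close> but cannot step on
    \<open>l\<close>, so each near cop covers at most one of its points. As more than
    \<open>\<kappa>\<close> points of \<open>l\<close> are unvisited, one of them stays
    free.\<close>
  have "l \<notin> cops_at \<sigma> r1 (Suc (Suc (2 * m)))"
    using cops_do_not_reach_uncovered[OF \<sigma> r1(2)] r1(3) by simp
  then have "card {p \<in> pts l. \<exists>c\<in>cops_at \<sigma> r1 (Suc (Suc (2 * m))). covers G c p} \<le> \<kappa> * 1"
      (is "card ?B \<le> _")
    by (intro card_covered_by_cops[OF \<sigma> near])
      (use Suc.prems T l card_covered_points[of l] in \<open>auto simp: lns_def pts_def\<close>)
  then have "card ?B < card (U \<inter> pts l)" using l(3) by linarith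
  moreover have "finite ?B" using fin by simp
  ultimately have "\<not> U \<inter> pts l \<subseteq> ?B" using card_mono not_less by blast
  then obtain p where p: "p \<in> U" "p \<in> pts l" "\<And>c. c \<in> cops_at \<sigma> r1 (Suc (Suc (2 * m))) \<Longrightarrow> \<not> covers G c p"
    by blast
  obtain r2 where r2: "robber_play G r2" "uncovered_upto G \<sigma> r2 (Suc (Suc (2 * m)))"
      "r2 (Suc (Suc (2 * m))) = p"
    and r2_eq: "\<And>s. s \<le> Suc (2 * m) \<Longrightarrow> r2 s = r1 s"
    by (rule extend_robber_play[OF r1(1,2), of p]) (use p r1(3) in \<open>auto simp: pts_def\<close>)
  have "r2 ` {..2 * m} = r ` {..2 * m}"
    by (rule image_cong) (use r1_eq r2_eq in auto)
  then have "r2 ` {..2 * Suc m} = insert p (insert l (r ` {..2 * m}))"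
    using r1(3) r2(3) r2_eq[of "Suc (2 * m)"] by (simp add: atMost_Suc)
  moreover have "l \<notin> P" using l P_L_disjoint by (auto simp: lns_def)
  moreover have "p \<in> P - r ` {..2 * m}" using p by (simp add: U_def)
  ultimately have "card (r2 ` {..2 * Suc m} \<inter> P) = Suc m + 1"
    using card_r by simp
  then show ?case
    using r2 p by (intro exI[of _ r2]) (auto simp: U_def)
qed

lemma robber_damages:
  assumes \<sigma>: "cop_strategy G k \<sigma>" and near: "card {j. j < k \<and> f (\<sigma> [] ! j) < T} \<le> \<kappa>"
    and T: "2 * s \<le> T" and s: "2 * (\<kappa> * q) + q + s \<le> q ^ 2" "s > 0"
  shows "\<exists>r. robber_play G r \<and> s \<le> card (damaged \<sigma> r)"
proof -
  \<comment> \<open>Round 0 already yields a point, so \<open>s - 1\<close> double moves give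
    \<open>s\<close> points.\<close>
  obtain r where r: "robber_play G r" "uncovered_upto G \<sigma> r (2 * (s - 1))"
      "card (r ` {..2 * (s - 1)} \<inter> P) = s - 1 + 1"
    using robber_evades[OF \<sigma> near T s(1), of "s - 1"] s(2) by auto
  have "finite (damaged \<sigma> r)"
    using damaged_subset[OF r(1), of \<sigma>] pair_finite_verts by (rule finite_subset)
  then have "card (r ` {..2 * (s - 1)} \<inter> P) \<le> card (damaged \<sigma> r)"
    by (rule card_mono) (use image_subset_damaged[OF \<sigma> r(2)] in auto)
  then show ?thesis using r s(2) by auto
qed

end

section \<open>Copies of graphs\<close>

text \<open>Serves to change the vertex type: the graph is built on \<open>vert\<close>, while the
  theorem asks for natural numbers as vertices.\<close>

definition map_pair_graph :: "('a \<Rightarrow> 'b) \<Rightarrow> 'a pair_pre_digraph \<Rightarrow> 'b pair_pre_digraph" where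
  "map_pair_graph \<phi> G = \<lparr>pverts = \<phi> ` pverts G, parcs = map_prod \<phi> \<phi> ` parcs G\<rparr>"

lemma map_pair_graph_simps [simp]:
  "pverts (map_pair_graph \<phi> G) = \<phi> ` pverts G"
  "parcs (map_pair_graph \<phi> G) = map_prod \<phi> \<phi> ` parcs G"
  by (simp_all add: map_pair_graph_def)

lemma (in pair_graph) pair_graph_map_pair_graph:
  assumes "inj_on \<phi> (pverts G)"
  shows "pair_graph (map_pair_graph \<phi> G)"
proof
  show "fst e \<in> pverts (map_pair_graph \<phi> G)" "snd e \<in> pverts (map_pair_graph \<phi> G)"
    if "e \<in> parcs (map_pair_graph \<phi> G)" for e
    using that in_arcsD1 in_arcsD2 by auto
  show "finite (pverts (map_pair_graph \<phi> G))" "finite (parcs (map_pair_graph \<phi> G))"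
    using pair_finite_verts pair_finite_arcs by simp_all
  show "fst e \<noteq> snd e" if "e \<in> parcs (map_pair_graph \<phi> G)" for e
  proof -
    from that obtain u v where uv: "(u, v) \<in> parcs G" "e = (\<phi> u, \<phi> v)" by auto
    then have "u \<in> pverts G" "v \<in> pverts G" "u \<noteq> v"
      using in_arcsD1 in_arcsD2 no_loops' by blast+
    then show ?thesis using uv assms by (auto dest: inj_onD)
  qed
  show "symmetric (with_proj (map_pair_graph \<phi> G))"
    unfolding symmetric_def with_proj_simps
    by (rule symI) (use arcs_symmetric in force)
qed

text \<open>A cop strategy on the copy is pulled back to \<open>G\<close>, and a robber's play that
  does well against it in \<open>G\<close> is pushed forward.\<close>

lemma dmg_le_dmg_map_pair_graph:
  assumes G: "pair_graph G" "pverts G \<noteq> {}" and \<phi>: "inj_on \<phi> (pverts G)"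
  shows "dmg k G \<le> dmg k (map_pair_graph \<phi> G)"
proof -
  interpret G: pair_graph G by fact
  interpret X: pair_graph "map_pair_graph \<phi> G" by (rule G.pair_graph_map_pair_graph[OF \<phi>])
  define \<psi> where "\<psi> = the_inv_into (pverts G) \<phi>"
  have \<psi>: "\<psi> (\<phi> v) = v" if "v \<in> pverts G" for v
    using that by (simp add: \<psi>_def the_inv_into_f_f[OF \<phi>])
  have "\<exists>r. robber_play (map_pair_graph \<phi> G) r \<and> dmg k G \<le> card (damaged \<sigma> r)"
    if \<sigma>: "cop_strategy (map_pair_graph \<phi> G) k \<sigma>" for \<sigma>
  proof -
    define \<sigma>' where "\<sigma>' = (\<lambda>h. map \<psi> (\<sigma> (map \<phi> h)))"
    have move: "legal_move G (\<psi> u) (\<psi> v)" if "legal_move (map_pair_graph \<phi> G) u v" for u v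
      using that \<psi> G.in_arcsD1 G.in_arcsD2 by (auto simp: legal_move_def)
    have "cop_strategy G k \<sigma>'"
      using \<sigma> \<psi> unfolding cop_strategy_def \<sigma>'_def
      by (fastforce simp: list.rel_map intro: list.rel_mono_strong move)
    then obtain r where r: "robber_play G r" "dmg k G \<le> card (damaged \<sigma>' r)"
      using G.le_dmg_iff[OF G(2), of "dmg k G" k] by auto
    have verts: "r t \<in> pverts G" for t
      by (rule G.robber_play_verts[OF r(1)])
    have "robber_play (map_pair_graph \<phi> G) (\<phi> \<circ> r)"
      using r(1) unfolding robber_play_def legal_move_def by force
    moreover have "cops_at \<sigma>' r t = \<psi> ` cops_at \<sigma> (\<phi> \<circ> r) t" for t
      by (simp add: cops_at_def \<sigma>'_def)
    \<comment> \<open>A capture in the copy is one in \<open>G\<close> in the same round, so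
      vertices damaged in \<open>G\<close> have damaged images.\<close>
    then have "capture \<sigma>' r t" if "capture \<sigma> (\<phi> \<circ> r) t" for t
      using that \<psi>[OF verts] unfolding capture_def comp_def by (metis imageI)
    then have "\<phi> ` damaged \<sigma>' r \<subseteq> damaged \<sigma> (\<phi> \<circ> r)"
      by (fastforce simp: damaged_def)
    then have "card (\<phi> ` damaged \<sigma>' r) \<le> card (damaged \<sigma> (\<phi> \<circ> r))"
      using X.damaged_subset[OF \<open>robber_play (map_pair_graph \<phi> G) (\<phi> \<circ> r)\<close>, of \<sigma>]
      by (meson X.pair_finite_verts card_mono finite_subset)
    moreover have "card (\<phi> ` damaged \<sigma>' r) = card (damaged \<sigma>' r)"
      using G.damaged_subset[OF r(1)] \<phi> by (meson card_image inj_on_subset)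
    ultimately show ?thesis using r(2) by auto
  qed
  then show ?thesis
    using G(2) by (subst X.le_dmg_iff) auto
qed

text \<open>By symmetry it suffices that every vertex reaches one fixed vertex.\<close>

lemma connected_map_pair_graph:
  assumes "pair_graph G" "v0 \<in> pverts G"
    and reach: "\<And>v. v \<in> pverts G \<Longrightarrow> (v, v0) \<in> (parcs G)\<^sup>*"
    and \<phi>: "inj_on \<phi> (pverts G)"
  shows "Digraph_Component.connected (with_proj (map_pair_graph \<phi> G))"
proof -
  interpret G: pair_graph G by fact
  interpret X: pair_graph "map_pair_graph \<phi> G" by (rule G.pair_graph_map_pair_graph[OF \<phi>])
  have arc: "\<phi> u \<rightarrow>\<^sup>*\<^bsub>with_proj (map_pair_graph \<phi> G)\<^esub> \<phi> v" if "(u, v) \<in> parcs G" for u v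
    using that by (intro X.reachable_adjI) force
  have to: "\<phi> v \<rightarrow>\<^sup>*\<^bsub>with_proj (map_pair_graph \<phi> G)\<^esub> \<phi> v0" if "v \<in> pverts G" for v
    using reach[OF that]
  proof (induction rule: converse_rtrancl_induct)
    case base
    show ?case using assms(2) by (intro X.reachable_refl) simp
  next
    case (step u v)
    show ?case by (rule X.reachable_trans[OF arc[OF step(1)] step(3)])
  qed
  have all: "\<phi> u \<rightarrow>\<^sup>*\<^bsub>with_proj (map_pair_graph \<phi> G)\<^esub> \<phi> v" if "u \<in> pverts G" "v \<in> pverts G" for u v
    by (rule X.reachable_trans[OF to[OF that(1)] X.symmetric_reachable'[OF to[OF that(2)]]])
  \<comment> \<open>\<open>connected\<close> is expressed by paths in the symmetric closure, which
    contains the arcs.\<close>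
  have "(u, v) \<in> rtrancl_on (\<phi> ` pverts G) ((parcs (map_pair_graph \<phi> G))\<^sup>s)"
    if "u \<in> \<phi> ` pverts G" "v \<in> \<phi> ` pverts G" for u v
  proof -
    from that obtain x y where xy: "x \<in> pverts G" "u = \<phi> x" "y \<in> pverts G" "v = \<phi> y"
      by blast
    have "(u, v) \<in> rtrancl_on (\<phi> ` pverts G) (parcs (map_pair_graph \<phi> G))"
      using all[OF xy(1,3)] unfolding reachable_def with_proj_simps map_pair_graph_simps xy(2,4) .
    then show ?thesis
      by (rule rtrancl_on_mono[rotated 2]) (simp_all add: symcl_def)
  qed
  moreover have "\<phi> ` pverts G \<noteq> {}" using assms(2) by blast
  ultimately show ?thesis
    unfolding connected_conv with_proj_simps map_pair_graph_simps by blast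
qed

section \<open>Affine planes hanging on a path\<close>

text \<open>
  \<open>Point i x y\<close> lies on \<open>Line i a b\<close> iff \<open>y = a x + b\<close>. The points of plane \<open>i\<close> with \<open>x = 0\<close>, of which
  every line contains exactly one, are joined to vertex \<open>2 T i + T\<close> of the path, so that within
  distance \<open>T\<close> on the path no other plane is attached.
\<close>

datatype 'a vert = Spine nat | Point nat 'a 'a | Line nat 'a 'a

text \<open>Projection to the path: a plane goes to the vertex where it is attached, the middle of a
  block of \<open>2 * T\<close> path vertices.\<close>

primrec position :: "nat \<Rightarrow> 'a vert \<Rightarrow> nat" where
  "position T (Spine j) = j"
| "position T (Point i x y) = 2 * T * i + T"
| "position T (Line i a b) = 2 * T * i + T"

primrec in_plane :: "nat \<Rightarrow> 'a vert \<Rightarrow> bool" where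
  "in_plane i (Spine j) \<longleftrightarrow> False"
| "in_plane i (Point i' x y) \<longleftrightarrow> i' = i"
| "in_plane i (Line i' a b) \<longleftrightarrow> i' = i"

text \<open>Subtraction is truncated, so the two differences add up to the distance along the path
  from the attachment vertex of plane \<open>i\<close>; the \<open>1\<close> is the edge into the
  plane. This is the \<open>f\<close> of \<open>robber_arena\<close>.\<close>

definition gauge :: "nat \<Rightarrow> nat \<Rightarrow> 'a vert \<Rightarrow> nat" where
  "gauge T i v = (if in_plane i v then 0 else
     1 + (position T v - (2 * T * i + T)) + ((2 * T * i + T) - position T v))"

text \<open>Each edge is listed in one orientation and symmetrised in
  \<open>planes_on_path\<close>.\<close>

fun half_adj :: "nat \<Rightarrow> 'a::field vert \<Rightarrow> 'a vert \<Rightarrow> bool" where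
  "half_adj T (Spine j) (Spine j') \<longleftrightarrow> j' = Suc j"
| "half_adj T (Spine j) (Point i x y) \<longleftrightarrow> x = 0 \<and> j = 2 * T * i + T"
| "half_adj T (Point i x y) (Line i' a b) \<longleftrightarrow> i' = i \<and> y = a * x + b"
| "half_adj T _ _ \<longleftrightarrow> False"

definition plane_points :: "'a set \<Rightarrow> nat \<Rightarrow> 'a vert set" where
  "plane_points F i = (\<lambda>(x, y). Point i x y) ` (F \<times> F)"

definition plane_lines :: "'a set \<Rightarrow> nat \<Rightarrow> 'a vert set" where
  "plane_lines F i = (\<lambda>(a, b). Line i a b) ` (F \<times> F)"

text \<open>The path length \<open>K\<close> is a parameter of its own, so that the order of the
  graph can be adjusted exactly.\<close>

definition planes_on_path :: "'a::field set \<Rightarrow> nat \<Rightarrow> nat \<Rightarrow> nat \<Rightarrow> 'a vert pair_pre_digraph" where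
  "planes_on_path F M T K =
    (let V = Spine ` {..<K} \<union> (\<Union>i<M. plane_points F i \<union> plane_lines F i)
     in \<lparr>pverts = V, parcs = {(u, v). u \<in> V \<and> v \<in> V \<and> (half_adj T u v \<or> half_adj T v u)}\<rparr>)"

section \<open>Adjacency, covering and distance to a plane\<close>

lemma pverts_planes_on_path:
  "pverts (planes_on_path F M T K) = Spine ` {..<K} \<union> (\<Union>i<M. plane_points F i \<union> plane_lines F i)"
  by (simp add: planes_on_path_def Let_def)

lemma pverts_planes_on_path_simps [simp]:
  "Spine j \<in> pverts (planes_on_path F M T K) \<longleftrightarrow> j < K"
  "Point i x y \<in> pverts (planes_on_path F M T K) \<longleftrightarrow> i < M \<and> x \<in> F \<and> y \<in> F"
  "Line i a b \<in> pverts (planes_on_path F M T K) \<longleftrightarrow> i < M \<and> a \<in> F \<and> b \<in> F"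
  by (auto simp: pverts_planes_on_path plane_points_def plane_lines_def)

lemma parcs_planes_on_path:
  "(u, v) \<in> parcs (planes_on_path F M T K) \<longleftrightarrow>
    u \<in> pverts (planes_on_path F M T K) \<and> v \<in> pverts (planes_on_path F M T K) \<and>
    (half_adj T u v \<or> half_adj T v u)"
  by (simp add: planes_on_path_def Let_def)

lemma Line_Point_arc:
  "(Line i' a b, Point i x y) \<in> parcs (planes_on_path F M T K) \<Longrightarrow> i' = i \<and> y = a * x + b"
  by (simp add: parcs_planes_on_path)

lemma Point_Line_arc:
  "(Point i x y, Line i' a b) \<in> parcs (planes_on_path F M T K) \<Longrightarrow> i' = i \<and> y = a * x + b"
  by (simp add: parcs_planes_on_path)

lemma covers_planes_on_path_simps [simp]:
  "\<not> covers (planes_on_path F M T K) (Spine j) (Line i a b)"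
  "covers (planes_on_path F M T K) (Line i' a' b') (Line i a b) \<longleftrightarrow> i' = i \<and> a' = a \<and> b' = b"
  "covers (planes_on_path F M T K) (Point i' x' y') (Point i x y) \<longleftrightarrow> i' = i \<and> x' = x \<and> y' = y"
  by (auto simp: covers_def parcs_planes_on_path)

lemma Spine_covers_Point: "covers (planes_on_path F M T K) (Spine j) (Point i x y) \<Longrightarrow> x = 0"
  by (simp add: covers_def parcs_planes_on_path)

lemma gauge_Lipschitz: "half_adj T u v \<or> half_adj T v u \<Longrightarrow> gauge T i u \<le> gauge T i v + 1"
  by (cases u; cases v) (auto simp: gauge_def)

text \<open>Vertices of gauge below \<open>T\<close> project into the block around the attachment
  vertex of plane \<open>i\<close>. The blocks are disjoint, so a cop starts near at most one
  plane.\<close>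

lemma gauge_less_imp_position:
  assumes "gauge T i v < T"
  shows "position T v div (2 * T) = i"
proof -
  have "2 * T * i \<le> position T v \<and> position T v < 2 * T * i + 2 * T"
  proof (cases "in_plane i v")
    case True
    then show ?thesis using assms by (cases v) auto
  next
    case False
    then show ?thesis using assms by (auto simp: gauge_def)
  qed
  then show ?thesis
    by (intro div_nat_eqI) (auto simp: algebra_simps)
qed

text \<open>The field is a subset of a fixed type, because its order has to grow with the number of
  vertices while the type stays the same.\<close>

locale finite_subfield =
  fixes F :: "'a::field set"
  assumes finite_F: "finite F" and zero_F: "0 \<in> F" and one_F: "1 \<in> F"
    and add_F: "x \<in> F \<Longrightarrow> y \<in> F \<Longrightarrow> x + y \<in> F"
    and diff_F: "x \<in> F \<Longrightarrow> y \<in> F \<Longrightarrow> x - y \<in> F"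
    and mult_F: "x \<in> F \<Longrightarrow> y \<in> F \<Longrightarrow> x * y \<in> F"
    and divide_F: "x \<in> F \<Longrightarrow> y \<in> F \<Longrightarrow> x / y \<in> F"
begin

section \<open>Order, connectedness and incidence properties\<close>

lemma card_plane_points: "card (plane_points F i) = card F ^ 2"
  and card_plane_lines: "card (plane_lines F i) = card F ^ 2"
  unfolding plane_points_def plane_lines_def
  by (subst card_image; auto simp: inj_on_def power2_eq_square card_cartesian_product)+

lemma finite_plane_points: "finite (plane_points F i)"
  and finite_plane_lines: "finite (plane_lines F i)"
  by (simp_all add: plane_points_def plane_lines_def finite_F)

lemma card_pverts_planes_on_path: "card (pverts (planes_on_path F M T K)) = K + 2 * M * card F ^ 2"
proof -
  define A where "A = (\<lambda>i. plane_points F i \<union> plane_lines F i)"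
  have fin: "finite (A i)" for i
    by (simp add: A_def finite_plane_points finite_plane_lines)
  have "plane_points F i \<inter> plane_lines F i = {}" for i
    by (auto simp: plane_points_def plane_lines_def)
  then have card_A: "card (A i) = 2 * card F ^ 2" for i
    by (simp add: A_def card_Un_disjoint card_plane_points card_plane_lines
        finite_plane_points finite_plane_lines)
  have in_A: "in_plane i v" if "v \<in> A i" for i v
    using that by (auto simp: A_def plane_points_def plane_lines_def)
  have "A i \<inter> A i' = {}" if "i \<noteq> i'" for i i'
  proof (rule ccontr)
    assume "A i \<inter> A i' \<noteq> {}"
    then obtain v where "v \<in> A i" "v \<in> A i'" by auto
    then have "in_plane i v" "in_plane i' v" using in_A by simp_all
    then show False using that by (cases v) simp_all
  qed
  then have "card (\<Union>i<M. A i) = 2 * M * card F ^ 2"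
    using fin by (subst card_UN_disjoint) (simp_all add: card_A)
  moreover have "Spine ` {..<K} \<inter> (\<Union>i<M. A i) = {}"
  proof -
    have "Spine j \<notin> A i" for i j using in_A[of "Spine j" i] by auto
    then show ?thesis by auto
  qed
  moreover have "card (Spine ` {..<K} :: 'a vert set) = K"
    by (simp add: card_image inj_on_def)
  ultimately show ?thesis
    unfolding pverts_planes_on_path A_def[symmetric]
    by (subst card_Un_disjoint) (simp_all add: fin)
qed

lemma pair_graph_planes_on_path: "pair_graph (planes_on_path F M T K)"
proof
  let ?G = "planes_on_path F M T K"
  show "fst e \<in> pverts ?G" "snd e \<in> pverts ?G" "fst e \<noteq> snd e" if "e \<in> parcs ?G" for e
    using that by (cases e; cases "fst e"; auto simp: parcs_planes_on_path)+
  show fin: "finite (pverts ?G)"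
    by (simp add: pverts_planes_on_path finite_plane_points finite_plane_lines)
  have "parcs ?G \<subseteq> pverts ?G \<times> pverts ?G"
    by (auto simp: parcs_planes_on_path)
  then show "finite (parcs ?G)"
    using fin by (meson finite_SigmaI finite_subset)
  show "symmetric (with_proj ?G)"
    by (auto simp: symmetric_def parcs_planes_on_path intro: symI)
qed

text \<open>A point lies on a line of slope 0, a line meets the axis \<open>x = 0\<close>, the axis
  is joined to the path, and the path leads to \<open>Spine 0\<close>. The bound on \<open>K\<close>
  ensures that the attachment vertices exist.\<close>

lemma planes_on_path_reachable:
  assumes "2 * T * M \<le> K" "T > 0" and v: "v \<in> pverts (planes_on_path F M T K)"
  shows "(v, Spine 0) \<in> (parcs (planes_on_path F M T K))\<^sup>*"
proof -
  let ?E = "parcs (planes_on_path F M T K)"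
  have spine: "(Spine j, Spine 0) \<in> ?E\<^sup>*" if "j < K" for j
    using that
  proof (induction j)
    case (Suc j)
    then have "(Spine (Suc j), Spine j) \<in> ?E" by (simp add: parcs_planes_on_path)
    then show ?case using Suc by (meson Suc_lessD converse_rtrancl_into_rtrancl)
  qed simp
  have axis: "(Point i 0 y, Spine 0) \<in> ?E\<^sup>*" if "i < M" "y \<in> F" for i y
  proof -
    have "2 * T * Suc i \<le> 2 * T * M" using that by (intro mult_le_mono) auto
    then have "2 * T * i + T < K" using assms by simp
    then have "(Point i 0 y, Spine (2 * T * i + T)) \<in> ?E"
      using that by (simp add: parcs_planes_on_path zero_F)
    then show ?thesis using spine[OF \<open>2 * T * i + T < K\<close>] by (rule converse_rtrancl_into_rtrancl)
  qed
  have line: "(Line i a b, Spine 0) \<in> ?E\<^sup>*" if "i < M" "a \<in> F" "b \<in> F" for i a b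
  proof -
    have "(Line i a b, Point i 0 b) \<in> ?E"
      using that by (simp add: parcs_planes_on_path zero_F)
    then show ?thesis using axis[of i b] that by (meson converse_rtrancl_into_rtrancl)
  qed
  show ?thesis
  proof (cases v)
    case (Spine j)
    then show ?thesis using v spine by simp
  next
    case (Line i a b)
    then show ?thesis using v line by simp
  next
    case (Point i x y)
    then have "(v, Line i 0 y) \<in> ?E"
      using v by (simp add: parcs_planes_on_path zero_F)
    then show ?thesis
      using v Point line[of i 0 y] zero_F by (auto intro: converse_rtrancl_into_rtrancl)
  qed
qed

text \<open>Two points have at most one common line and two lines at most one common point. A path
  vertex is adjacent to no line and only to points with \<open>x = 0\<close>, of which each line
  contains just one, so cops on the path block no more than others.\<close>

lemma robber_arena_planes_on_path:
  assumes "i < M"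
  shows "robber_arena (planes_on_path F M T K) (plane_points F i) (plane_lines F i) (gauge T i) (card F)"
proof -
  let ?G = "planes_on_path F M T K"
  interpret pair_graph ?G by (rule pair_graph_planes_on_path)
  have image: "card S \<le> card F" if "S \<subseteq> g ` F" for S :: "'a vert set" and g
    using that finite_F by (meson card_image_le card_mono finite_imageI le_trans)
  have unique: "card S \<le> 1" if "S \<subseteq> A" "finite A" "\<And>w w'. w \<in> S \<Longrightarrow> w' \<in> S \<Longrightarrow> w = w'"
    for S A :: "'a vert set"
    using that by (metis One_nat_def card_le_Suc0_iff_eq finite_subset)
  show ?thesis
  proof
    show "plane_points F i \<subseteq> pverts ?G" "plane_lines F i \<subseteq> pverts ?G"
      using \<open>i < M\<close> by (auto simp: pverts_planes_on_path)
    show "plane_points F i \<inter> plane_lines F i = {}"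
      by (auto simp: plane_points_def plane_lines_def)
    show "gauge T i v = 0" if "v \<in> plane_points F i \<union> plane_lines F i" for v
      using that by (auto simp: gauge_def plane_points_def plane_lines_def)
    show "gauge T i u \<le> gauge T i v + 1" if "(u, v) \<in> parcs ?G" for u v
      using that gauge_Lipschitz by (auto simp: parcs_planes_on_path)
    show "card (plane_points F i) = card F ^ 2" by (rule card_plane_points)
    show "card {p \<in> plane_points F i. covers ?G u p} \<le> card F" if "u \<in> pverts ?G" for u
    proof (cases u)
      case (Spine j)
      show ?thesis
        by (rule image[of _ "Point i 0"])
          (auto simp: Spine covers_def parcs_planes_on_path plane_points_def)
    next
      case (Point i' x y)
      \<comment> \<open>A point covers at most itself among the points; the constant map fits this
        to \<open>image\<close>, and \<open>0 \<in> F\<close> makes \<open>F\<close>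
        non-empty.\<close>
      have "{p \<in> plane_points F i. covers ?G u p} \<subseteq> (\<lambda>_. u) ` F"
        using zero_F by (auto simp: Point covers_def parcs_planes_on_path plane_points_def)
      then show ?thesis by (rule image)
    next
      case (Line i' a b)
      show ?thesis
        by (rule image[of _ "\<lambda>x. Point i x (a * x + b)"])
          (auto simp: Line covers_def parcs_planes_on_path plane_points_def)
    qed
    show "card {l \<in> plane_lines F i. (v, l) \<in> parcs ?G} \<le> card F" if "v \<in> plane_points F i" for v
    proof -
      from that obtain x y where "v = Point i x y" by (auto simp: plane_points_def)
      then show ?thesis
        by (intro image[of _ "\<lambda>a. Line i a (y - a * x)"])
          (auto simp: parcs_planes_on_path plane_lines_def)
    qed
    show "card {p \<in> plane_points F i. \<not> (\<exists>l\<in>plane_lines F i. (v, l) \<in> parcs ?G \<and> (l, p) \<in> parcs ?G)} \<le> card F"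
      if "v \<in> plane_points F i" for v
    proof -
      from that obtain x0 y0 where v: "v = Point i x0 y0" "x0 \<in> F" "y0 \<in> F"
        by (auto simp: plane_points_def)
      \<comment> \<open>As there are no vertical lines, points not joined to \<open>v\<close> share
        its abscissa. Any other point lies with \<open>v\<close> on the line of slope
        \<open>a\<close> and intercept \<open>b\<close> below.\<close>
      have "\<exists>l\<in>plane_lines F i. (v, l) \<in> parcs ?G \<and> (l, Point i x y) \<in> parcs ?G"
        if xy: "x \<in> F" "y \<in> F" "x \<noteq> x0" for x y
      proof -
        define a where "a = (y - y0) / (x - x0)"
        define b where "b = y0 - a * x0"
        have "a \<in> F" "b \<in> F" using xy v by (simp_all add: a_def b_def divide_F diff_F mult_F)
        moreover have "y0 = a * x0 + b" by (simp add: b_def)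
        moreover have "a * (x - x0) = y - y0" using xy by (simp add: a_def)
        then have "y = a * x + b" by (simp add: b_def algebra_simps)
        ultimately show ?thesis
          using xy v \<open>i < M\<close>
          by (intro bexI[of _ "Line i a b"]) (auto simp: parcs_planes_on_path plane_lines_def)
      qed
      then have "{p \<in> plane_points F i. \<not> (\<exists>l\<in>plane_lines F i. (v, l) \<in> parcs ?G \<and> (l, p) \<in> parcs ?G)}
          \<subseteq> Point i x0 ` F"
        by (auto simp: plane_points_def)
      then show ?thesis by (rule image)
    qed
    show "card {l \<in> plane_lines F i. (v, l) \<in> parcs ?G \<and> covers ?G u l} \<le> 1"
      if v: "v \<in> plane_points F i" and u: "u \<in> pverts ?G" "u \<noteq> v" for u v
    proof (rule unique[OF _ finite_plane_lines])
      obtain x y where vxy: "v = Point i x y" using v by (auto simp: plane_points_def)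
      show "w = w'" if mem: "w \<in> {l \<in> plane_lines F i. (v, l) \<in> parcs ?G \<and> covers ?G u l}"
        "w' \<in> {l \<in> plane_lines F i. (v, l) \<in> parcs ?G \<and> covers ?G u l}" for w w'
      proof (cases u)
        case (Point i' x' y')
        obtain a b a' b' where w: "w = Line i a b" "w' = Line i a' b'"
          using mem by (auto simp: plane_lines_def)
        then have eq: "i' = i" "y = a * x + b" "y = a' * x + b'" "y' = a * x' + b" "y' = a' * x' + b'"
          using mem Point_Line_arc unfolding Point vxy covers_def by blast+
        \<comment> \<open>With equal abscissae \<open>u\<close> and \<open>v\<close>, which lie on a
          common line, would coincide. Comparing both lines at \<open>x\<close> and
          \<open>x'\<close> then makes their slopes equal.\<close>
        then have "x \<noteq> x'" using u(2) Point vxy by auto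
        moreover have "(a - a') * (x - x') = ((a * x + b) - (a' * x + b')) - ((a * x' + b) - (a' * x' + b'))"
          by (simp add: algebra_simps)
        then have "(a - a') * (x - x') = 0"
          unfolding eq(2-5)[symmetric] by simp
        ultimately show ?thesis using eq w by auto
      qed (use mem in \<open>auto simp: plane_lines_def\<close>)
    qed auto
    show "card {p \<in> plane_points F i. (l, p) \<in> parcs ?G \<and> covers ?G u p} \<le> 1"
      if l: "l \<in> plane_lines F i" and u: "u \<in> pverts ?G" "u \<noteq> l" for u l
    proof (rule unique[OF _ finite_plane_points])
      obtain a b where lab: "l = Line i a b" using l by (auto simp: plane_lines_def)
      show "w = w'" if mem: "w \<in> {p \<in> plane_points F i. (l, p) \<in> parcs ?G \<and> covers ?G u p}"
        "w' \<in> {p \<in> plane_points F i. (l, p) \<in> parcs ?G \<and> covers ?G u p}" for w w'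
      proof (cases u)
        case (Line i' a' b')
        obtain x y x' y' where w: "w = Point i x y" "w' = Point i x' y'"
          using mem by (auto simp: plane_points_def)
        then have eq: "i' = i" "y = a * x + b" "y' = a * x' + b" "y = a' * x + b'" "y' = a' * x' + b'"
          using mem Line_Point_arc unfolding Line lab covers_def by blast+
        \<comment> \<open>Parallel lines with a common point coincide, which would give
          \<open>u = l\<close>.\<close>
        then have "a \<noteq> a'" using u(2) Line lab by auto
        moreover have "(a - a') * (x - x') = ((a * x + b) - (a' * x + b')) - ((a * x' + b) - (a' * x' + b'))"
          by (simp add: algebra_simps)
        then have "(a - a') * (x - x') = 0"
          unfolding eq(2-5)[symmetric] by simp
        ultimately show ?thesis using eq w by auto
      next
        case (Spine j)
        then show ?thesis
          using mem by (auto simp: lab plane_points_def dest!: Spine_covers_Point Line_Point_arc)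
      qed (use mem in \<open>auto simp: plane_points_def\<close>)
    qed auto
  qed
qed

text \<open>Pigeonhole: with fewer than \<open>M * (\<kappa> + 1)\<close> cops, at most
  \<open>\<kappa>\<close> start near some one of the \<open>M\<close> planes. The robber plays in
  that plane.\<close>

lemma le_dmg_planes_on_path:
  assumes "2 * T * M \<le> K" "T > 0" and k: "k < M * (\<kappa> + 1)"
    and T: "2 * s \<le> T" and s: "2 * (\<kappa> * card F) + card F + s \<le> card F ^ 2" "s > 0"
  shows "s \<le> dmg k (planes_on_path F M T K)"
proof -
  let ?G = "planes_on_path F M T K"
  interpret pair_graph ?G by (rule pair_graph_planes_on_path)
  have "M > 0" using k by (cases M) auto
  then have "K > 0" using assms(1,2) by (cases K) auto
  then have ne: "pverts ?G \<noteq> {}" by (auto simp: pverts_planes_on_path)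
  have "\<exists>r. robber_play ?G r \<and> s \<le> card (damaged \<sigma> r)" if \<sigma>: "cop_strategy ?G k \<sigma>" for \<sigma>
  proof -
    define J where "J = (\<lambda>i. {j. j < k \<and> position T (\<sigma> [] ! j) div (2 * T) = i})"
    have "(\<Sum>i<M. card (J i)) = card (\<Union>i<M. J i)"
      by (rule card_UN_disjoint[symmetric]) (auto simp: J_def)
    also have "\<dots> \<le> card {..<k}"
      by (rule card_mono) (auto simp: J_def)
    finally have sum_J: "(\<Sum>i<M. card (J i)) \<le> k" by simp
    have "\<exists>i<M. card (J i) \<le> \<kappa>"
    proof (rule ccontr)
      assume "\<not> ?thesis"
      then have "(\<Sum>i<M. \<kappa> + 1) \<le> (\<Sum>i<M. card (J i))"
        by (intro sum_mono) (auto simp: not_le)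
      then show False using sum_J k by simp
    qed
    then obtain i where i: "i < M" "card (J i) \<le> \<kappa>" by blast
    interpret robber_arena ?G "plane_points F i" "plane_lines F i" "gauge T i" "card F"
      by (rule robber_arena_planes_on_path[OF i(1)])
    have "card {j. j < k \<and> gauge T i (\<sigma> [] ! j) < T} \<le> card (J i)"
      by (rule card_mono) (auto simp: J_def gauge_less_imp_position)
    then show ?thesis
      using i(2) by (intro robber_damages[OF \<sigma> _ T s]) linarith
  qed
  then show ?thesis using ne by (simp add: le_dmg_iff)
qed

end

section \<open>Finite fields of order a power of two\<close>

text \<open>The roots of \<open>x ^ q - x\<close> with \<open>q = 2 ^ e\<close>. Taking
  \<open>q\<close>-th powers is additive in characteristic two, which gives closure; the polynomial
  splits with simple roots, which gives the cardinality.\<close>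

lemma finite_subfield_power_of_two:
  assumes e: "e > 0"
  shows "finite_subfield {x :: bit alg_closure. x ^ 2 ^ e = x}" (is "finite_subfield ?F")
    and "card {x :: bit alg_closure. x ^ 2 ^ e = x} = 2 ^ e"
proof -
  define F where "F = ?F"
  have char_bit: "CHAR(bit) = 2"
  proof (rule CHAR_eqI)
    show "of_nat 2 = (0 :: bit)" by simp
    show "2 dvd n" if "of_nat n = (0 :: bit)" for n
      using that by (metis even_of_nat_iff even_zero)
  qed
  then have char: "CHAR(bit alg_closure) = 2" by simp
  define q :: nat where "q = 2 ^ e"
  \<comment> \<open>\<open>q > 1\<close> ensures that \<open>p\<close> below has degree
    \<open>q\<close> instead of vanishing.\<close>
  have q: "q > 1" "even q" using e one_less_power[of "2::nat" e] by (auto simp: q_def)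
  have q0: "of_nat q = (0 :: bit alg_closure)"
    using q char by (metis of_nat_eq_0_iff_char_dvd)
  have add: "(x + y) ^ q = x ^ q + y ^ q" for x y :: "bit alg_closure"
    by (rule freshmans_dream'[where n = e]) (simp_all add: char_bit q_def)
  have neg: "- x = x" for x :: "bit alg_closure"
    using char by (rule uminus_CHAR_2)
  define p :: "bit alg_closure poly" where "p = monom 1 q - monom 1 1"
  have F: "F = {x. poly p x = 0}"
    by (auto simp: F_def p_def poly_monom q_def)
  have deg: "degree p = q"
    using q degree_add_eq_left[of "- monom 1 1" "monom (1 :: bit alg_closure) q"]
    by (simp add: p_def degree_monom_eq)
  then have "p \<noteq> 0" using q by auto
  then obtain A where A: "size A = degree p" "p = smult (lead_coeff p) (\<Prod>x\<in>#A. [:-x, 1:])"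
    using alg_closed_imp_factorization by blast
  have deriv: "pderiv p = - 1"
    using q by (simp add: p_def pderiv_diff pderiv_monom q0 monom_eq_1)
  have "proots (\<Prod>x\<in>#A. [:-x, 1:]) = A"
    by (induction A) (simp_all add: proots_mult prod_mset_zero_iff image_iff del: mult_pCons_left)
  then have "proots p = A"
    using \<open>p \<noteq> 0\<close> by (subst A(2)) simp
  \<comment> \<open>A multiple root would also be a zero of the derivative, which is constantly
    \<open>-1\<close> because \<open>q\<close> is 0 in the field.\<close>
  have "count (proots p) x \<le> 1" for x
  proof (rule ccontr)
    assume "\<not> count (proots p) x \<le> 1"
    then have "[:-x, 1:] ^ 2 dvd p"
      using \<open>p \<noteq> 0\<close> by (simp add: order_divides)
    then obtain r where "p = [:-x, 1:] ^ 2 * r" by (elim dvdE)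
    then have "poly (pderiv p) x = 0"
      by (simp add: pderiv_mult power2_eq_square del: mult_pCons_left mult_pCons_right)
    then show False by (simp add: deriv)
  qed
  then have "proots p = mset_set (set_mset (proots p))"
    by (intro multiset_eqI) (metis count_mset_set(1) count_mset_set(3) finite_set_mset le_antisym less_one not_in_iff not_less)
  then have "card (set_mset (proots p)) = size (proots p)"
    by (metis size_mset_set)
  moreover have "set_mset (proots p) = F"
    using \<open>p \<noteq> 0\<close> by (simp add: F)
  ultimately show "card ?F = 2 ^ e"
    using A deg \<open>proots p = A\<close> by (simp add: F_def q_def)
  have "finite F" using \<open>set_mset (proots p) = F\<close> by (metis finite_set_mset)
  have plus: "x + y \<in> F" if "x \<in> F" "y \<in> F" for x y
    using that add unfolding F_def q_def by simp
  have "finite_subfield F"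
  proof
    show "finite F" by fact
    show "0 \<in> F" "1 \<in> F" by (simp_all add: F_def)
    show "x + y \<in> F" if "x \<in> F" "y \<in> F" for x y
      using that by (rule plus)
    show "x - y \<in> F" if "x \<in> F" "y \<in> F" for x y
      using plus[OF that] neg[of y] by (metis diff_conv_add_uminus)
    show "x * y \<in> F" "x / y \<in> F" if "x \<in> F" "y \<in> F" for x y
      using that unfolding F_def by (simp_all add: power_mult_distrib power_divide)
  qed
  then show "finite_subfield ?F" by (simp add: F_def)
qed

section \<open>The lower bound\<close>

text \<open>Some power of two lies within a factor of two of the cube root of \<open>n / c\<close>,
  so using only field orders that are powers of two costs a constant factor.\<close>

lemma powers_of_two_bracket:
  fixes c n :: nat
  assumes "c > 0" "c \<le> n"
  obtains d where "c * (2 ^ d) ^ 3 \<le> n" "n < c * (2 ^ Suc d) ^ 3"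
proof -
  define D where "D = (LEAST D. n < c * (2 ^ D) ^ 3)"
  have "n < 2 ^ n" by simp
  also have "2 ^ n \<le> c * (2 ^ n) ^ 3"
    using assms(1) by (simp add: self_le_power mult_le_mono[of 1 c "2 ^ n" "(2 ^ n) ^ 3", simplified])
  finally have D: "n < c * (2 ^ D) ^ 3" unfolding D_def by (rule LeastI)
  \<comment> \<open>The least exponent is not 0 since \<open>c \<le> n\<close>.\<close>
  with assms obtain d where "D = Suc d" by (cases D) auto
  then have "c * (2 ^ d) ^ 3 \<le> n"
    using not_less_Least[of d "\<lambda>D. n < c * (2 ^ D) ^ 3"] by (simp add: D_def[symmetric])
  then show thesis using that D \<open>D = Suc d\<close> by blast
qed

theorem theorem2p8:
  shows "\<exists>C::real. C > 0 \<and> (\<exists>N::nat. \<forall>n\<ge>N. \<exists>X :: nat pair_pre_digraph.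
           pair_graph X \<and> Digraph_Component.connected (with_proj X) \<and> card (pverts X) = n \<and>
           real (th_d X) \<ge> C * real n powr (2 / 3))"
proof (intro exI[of _ "1 / 128 :: real"] exI[of _ "2048 :: nat"] conjI allI impI)
  show "(1 / 128 :: real) > 0" by simp
next
  fix n :: nat
  assume n: "n \<ge> 2048"
  \<comment> \<open>With \<open>r = 2 ^ d\<close>, the planes take \<open>1024 * r ^ 3\<close>
    vertices and the path needs at least as many; hence the factor 2048.\<close>
  obtain d where d: "2048 * (2 ^ d) ^ 3 \<le> n" "n < 2048 * (2 ^ Suc d) ^ 3"
    using powers_of_two_bracket[of 2048 n] n by auto
  define r :: nat where "r = 2 ^ d"
  have r: "r > 0" "2048 * r ^ 3 \<le> n" "n < 16384 * r ^ 3"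
    using d by (simp_all add: r_def power_mult_distrib)
  define F where "F = {x :: bit alg_closure. x ^ 2 ^ (d + 3) = x}"
  interpret finite_subfield F
    unfolding F_def by (rule finite_subfield_power_of_two) simp
  have card_F: "card F = 8 * r"
    unfolding F_def by (subst finite_subfield_power_of_two) (simp_all add: r_def power_add)
  \<comment> \<open>In terms of the field order \<open>q = 8 * r\<close>, there are
    \<open>M = q\<close> planes and \<open>T = q ^ 2\<close>. The path takes all remaining vertices,
    so that the order is exactly \<open>n\<close>.\<close>
  define M where "M = 8 * r"
  define T where "T = 64 * r ^ 2"
  define K where "K = n - 2 * M * card F ^ 2"
  define G where "G = planes_on_path F M T K"
  have vol: "2 * M * card F ^ 2 = 1024 * r ^ 3" "2 * T * M = 1024 * r ^ 3"
    by (simp_all add: M_def T_def card_F power_mult_distrib power2_eq_square power3_eq_cube)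
  have K: "2 * T * M \<le> K" "K + 2 * M * card F ^ 2 = n"
    using r(2) unfolding K_def vol by linarith+
  have "T > 0" using r by (simp add: T_def)
  have pair_graph_G: "pair_graph G" and card_G: "card (pverts G) = n"
    unfolding G_def by (rule pair_graph_planes_on_path) (simp add: card_pverts_planes_on_path K)
  then have fin: "finite (pverts G)" by (simp add: pair_graph_def pair_digraph_def pair_fin_digraph.pair_finite_verts)
  obtain \<phi> where "bij_betw \<phi> (pverts G) {0..<n}"
    using ex_bij_betw_finite_nat[OF fin] card_G by auto
  then have \<phi>: "inj_on \<phi> (pverts G)" "\<phi> ` pverts G = {0..<n}"
    by (simp_all add: bij_betw_def)
  define X where "X = map_pair_graph \<phi> G"
  have dmg: "32 * r ^ 2 \<le> dmg k X" if "k < 8 * r ^ 2" for k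
  proof -
    have "32 * r ^ 2 \<le> dmg k G"
      unfolding G_def
    \<comment> \<open>Here \<open>\<kappa> = q / 8\<close> and half of the points are to be damaged:
      \<open>16 * r ^ 2 + 8 * r + 32 * r ^ 2\<close> fits into
      \<open>q ^ 2 = 64 * r ^ 2\<close>.\<close>
    proof (rule le_dmg_planes_on_path[OF K(1) \<open>T > 0\<close>, where \<kappa> = r])
      show "k < M * (r + 1)" using that by (simp add: M_def power2_eq_square)
      show "2 * (32 * r ^ 2) \<le> T" by (simp add: T_def)
      have "8 * r \<le> 16 * r ^ 2" using r(1) by (simp add: power2_eq_square)
      then show "2 * (r * card F) + card F + 32 * r ^ 2 \<le> card F ^ 2"
        by (simp add: card_F power2_eq_square)
      show "32 * r ^ 2 > 0" using r by simp
    qed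
    also have "\<dots> \<le> dmg k X"
      unfolding X_def using n card_G by (intro dmg_le_dmg_map_pair_graph pair_graph_G \<phi>(1)) auto
    finally show ?thesis .
  qed
  have card_X: "card (pverts X) = n" by (simp add: X_def \<phi>(2))
  \<comment> \<open>Either the number of cops alone reaches the bound, or the damage does.\<close>
  have "8 * r ^ 2 \<le> k + dmg k X" for k
    using dmg[of k] by (cases "k < 8 * r ^ 2") auto
  then have "8 * r ^ 2 \<le> th_d X"
    unfolding th_d_def using n card_X by (subst Min_ge_iff) auto
  \<comment> \<open>Rounding \<open>16384 * r ^ 3\<close> up to the cube \<open>(32 * r) ^ 3\<close>
    bounds the power of \<open>n\<close> by \<open>1024 * r ^ 2 = 128 * (8 * r ^ 2)\<close>; hence
    the constant \<open>1 / 128\<close>.\<close>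
  have "real n powr (2 / 3) \<le> (real (32 * r) ^ 3) powr (2 / 3)"
  proof (rule powr_mono2)
    have "n \<le> (32 * r) ^ 3" using r(3) by (simp add: power_mult_distrib)
    then show "real n \<le> real (32 * r) ^ 3" by (metis of_nat_le_iff of_nat_power)
  qed simp_all
  also have "\<dots> = (real (32 * r) powr 3) powr (2 / 3)"
    by (subst powr_numeral) simp_all
  also have "\<dots> = real (32 * r) powr 2"
    unfolding powr_powr by simp
  also have "\<dots> = real (32 * r) ^ 2"
    by (rule powr_numeral) simp
  finally have "1 / 128 * real n powr (2 / 3) \<le> real (8 * r ^ 2)"
    by (simp add: power_mult_distrib)
  also have "\<dots> \<le> real (th_d X)"
    using \<open>8 * r ^ 2 \<le> th_d X\<close> by (simp only: of_nat_le_iff)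
  finally have "1 / 128 * real n powr (2 / 3) \<le> real (th_d X)" .
  moreover have "pair_graph X"
    unfolding X_def by (rule pair_graph.pair_graph_map_pair_graph[OF pair_graph_G \<phi>(1)])
  moreover have "Digraph_Component.connected (with_proj X)"
    unfolding X_def
  proof (rule connected_map_pair_graph[OF pair_graph_G _ _ \<phi>(1)])
    have "K > 0" using K(1) \<open>T > 0\<close> r(1) by (cases K) (auto simp: M_def)
    then show "Spine 0 \<in> pverts G" by (simp add: G_def)
    show "(v, Spine 0) \<in> (parcs G)\<^sup>*" if "v \<in> pverts G" for v
      using planes_on_path_reachable[OF K(1) \<open>T > 0\<close>] that by (simp add: G_def)
  qed
  ultimately show "\<exists>X :: nat pair_pre_digraph. pair_graph X \<and>
      Digraph_Component.connected (with_proj X) \<and> card (pverts X) = n \<and>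
      real (th_d X) \<ge> 1 / 128 * real n powr (2 / 3)"
    using card_X by blast
qed

end
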